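(* If $G$ is a triangle-free graph, then $\chi(G)\le\max\{3,\,Z(G)\}$. In particular, every triangle-free graph $G$ with $Z(G)\ge 3$ satisfies $\chi(G)\le Z(G)$.
   Context: All graphs are finite, undirected and simple. $\chi(G)$ denotes the chromatic number of $G$. A graph is triangle-free if it contains no $K_3$. Zero forcing number: let each vertex of $G$ be initially coloured black or white. Colour-change rule: if a black vertex $u$ has exactly one white neighbour $v$, then $v$ may be recoloured black ($u$ forces $v$). A set $B\subseteq V(G)$ is a zero forcing set if, starting with exactly the vertices of $B$ black, repeated application of the colour-change rule makes every vertex of $G$ black. The zero forcing number $Z(G)$ is the minimum size of a zero forcing set of $G$. *)

theory Defs
  imports "Graph_Theory.Graph_Theory"
begin

text \<open>
  Finite simple undirected graphs are the symmetric loop-free pair digraphs of locale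
  \<^locale>\<open>pair_graph\<close>: each undirected edge is a pair of opposite arcs.
  The null graph is allowed.
\<close>

definition triangle_free :: "'a pair_pre_digraph \<Rightarrow> bool" where
  "triangle_free G \<longleftrightarrow>
     \<not> (\<exists>H :: 'a pair_pre_digraph. subgraph (with_proj H) (with_proj G) \<and> K\<^bsub>3\<^esub> (with_proj H))"

definition colourable :: "'a pair_pre_digraph \<Rightarrow> nat \<Rightarrow> bool" where
  "colourable G k \<longleftrightarrow>
     (\<exists>c :: 'a \<Rightarrow> nat. c ` pverts G \<subseteq> {..<k} \<and> (\<forall>(u, v) \<in> parcs G. c u \<noteq> c v))"

definition chromatic_number :: "'a pair_pre_digraph \<Rightarrow> nat" where
  "chromatic_number G = (LEAST k. colourable G k)"

text \<open>A colouring in black and white is represented by its set of black vertices.\<close>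

inductive forcing_step :: "'a pair_pre_digraph \<Rightarrow> 'a set \<Rightarrow> 'a set \<Rightarrow> bool" for G where
  "u \<in> B \<Longrightarrow> {w. (u, w) \<in> parcs G \<and> w \<notin> B} = {v} \<Longrightarrow> forcing_step G B (insert v B)"

definition zero_forcing_set :: "'a pair_pre_digraph \<Rightarrow> 'a set \<Rightarrow> bool" where
  "zero_forcing_set G B \<longleftrightarrow> B \<subseteq> pverts G \<and> (forcing_step G)\<^sup>*\<^sup>* B (pverts G)"

definition zero_forcing_number :: "'a pair_pre_digraph \<Rightarrow> nat" where
  "zero_forcing_number G = (LEAST k. \<exists>B. zero_forcing_set G B \<and> card B = k)"

text \<open>On finite simple graphs both minima are attained.\<close>

lemma colourable_chromatic_number:
  assumes "pair_graph G"
  shows "colourable G (chromatic_number G)"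
proof -
  interpret pair_graph G by fact
  obtain c :: "'a \<Rightarrow> nat" where c: "bij_betw c (pverts G) {0..<card (pverts G)}"
    using ex_bij_betw_finite_nat[OF pair_finite_verts] by blast
  have "c u \<noteq> c v" if "(u, v) \<in> parcs G" for u v
    using that c pair_no_loops[OF that] in_arcsD1[OF that] in_arcsD2[OF that]
    by (auto simp: bij_betw_def dest: inj_onD)
  then have "colourable G (card (pverts G))"
    using c unfolding colourable_def bij_betw_def by (intro exI[of _ c]) auto
  then show ?thesis
    unfolding chromatic_number_def by (rule LeastI)
qed

lemma zero_forcing_number_attained:
  "\<exists>B. zero_forcing_set G B \<and> card B = zero_forcing_number G"
proof -
  have "zero_forcing_set G (pverts G)"
    by (simp add: zero_forcing_set_def)
  then have "\<exists>k. \<exists>B. zero_forcing_set G B \<and> card B = k"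
    by blast
  then show ?thesis
    unfolding zero_forcing_number_def by (rule LeastI_ex)
qed

text \<open>Containing no $K_3$ amounts to having no three pairwise adjacent vertices.\<close>

lemma triangle_free_iff:
  assumes "pair_graph G"
  shows "triangle_free G \<longleftrightarrow>
    \<not> (\<exists>u v w. (u, v) \<in> parcs G \<and> (v, w) \<in> parcs G \<and> (u, w) \<in> parcs G)"
proof -
  interpret pair_graph G by fact
  have "\<exists>H :: 'a pair_pre_digraph. subgraph (with_proj H) (with_proj G) \<and> K\<^bsub>3\<^esub> (with_proj H)"
    if e: "(u, v) \<in> parcs G" "(v, w) \<in> parcs G" "(u, w) \<in> parcs G" for u v w
  proof -
    define H where "H = \<lparr>pverts = {u, v, w},
      parcs = {(x, y). (x, y) \<in> {u, v, w} \<times> {u, v, w} \<and> x \<noteq> y}\<rparr>"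
    have ne: "u \<noteq> v" "v \<noteq> w" "u \<noteq> w"
      using e pair_no_loops by force+
    have s: "(y, x) \<in> parcs G" if "(x, y) \<in> parcs G" for x y
      using pair_sym_arcs that by (auto simp: symmetric_def dest: symD)
    have "K\<^bsub>3\<^esub> (with_proj H)"
      using ne by (auto simp: complete_digraph_pair_def H_def)
    moreover have "pverts H \<subseteq> pverts G" "parcs H \<subseteq> parcs G"
      using e s in_arcsD1 in_arcsD2 by (auto simp: H_def)
    moreover have "wf_digraph (with_proj H)"
      by unfold_locales (auto simp: H_def)
    ultimately show ?thesis
      using wf_digraph by (auto simp: subgraph_def compatible_def)
  qed
  moreover have "\<exists>u v w. (u, v) \<in> parcs G \<and> (v, w) \<in> parcs G \<and> (u, w) \<in> parcs G"
    if H: "subgraph (with_proj H) (with_proj G)" "K\<^bsub>3\<^esub> (with_proj H)" for H :: "'a pair_pre_digraph"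
  proof -
    from H obtain u v w where "pverts H = {u, v, w}" "u \<noteq> v" "v \<noteq> w" "u \<noteq> w"
      by (auto simp: complete_digraph_pair_def card_3_iff)
    then have "(u, v) \<in> parcs H" "(v, w) \<in> parcs H" "(u, w) \<in> parcs H"
      using H by (auto simp: complete_digraph_pair_def)
    moreover have "parcs H \<subseteq> parcs G"
      using H by (simp add: subgraph_def)
    ultimately show ?thesis by blast
  qed
  ultimately show ?thesis
    unfolding triangle_free_def by blast
qed

end

theory Submission
  imports Defs
begin

text \<open>
  During a forcing process from a set \<open>B\<close> the black vertices that have not yet forced form a
  frontier \<open>A\<close> with \<open>|A| \<le> |B|\<close>: a force of \<open>v\<close> by \<open>u\<close> replaces \<open>u\<close> by \<open>v\<close> in it. Black vertices
  behind the frontier have no white neighbours, so a newly forced vertex sees only frontier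
  vertices. Colouring greedily in the order of forcing thus costs at most \<open>|B| + 1\<close> colours, and
  the task is to save one.

  Let \<open>m = max 3 |B|\<close>. Instead of one colouring, the proof keeps track of which colourings of the
  frontier extend to all black vertices. The invariant, \<open>flexible\<close> below, is that every proper
  \<open>m\<close>-colouring of \<open>A\<close> extends, except possibly, and only if \<open>A\<close> is independent, those that use all
  \<open>m\<close> colours. At the start this is trivial, since \<open>A\<close> is the whole black set. Lemma
  \<open>flexible_force\<close> shows that a force preserves it: a colouring of the new frontier is pulled back to
  the old one by choosing a colour for \<open>u\<close>, and the only way in which this choice can be blocked
  makes \<open>u\<close> adjacent to the whole new frontier, which is then independent because there are no
  triangles. At the end some colouring of the frontier is not exceptional, and it extends to
  the whole graph.
\<close>

definition proper_colouring :: "('a \<times> 'a) set \<Rightarrow> nat \<Rightarrow> 'a set \<Rightarrow> ('a \<Rightarrow> nat) \<Rightarrow> bool" where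
  "proper_colouring E m S c \<longleftrightarrow>
     c ` S \<subseteq> {..<m} \<and> (\<forall>x\<in>S. \<forall>y\<in>S. (x, y) \<in> E \<longrightarrow> c x \<noteq> c y)"

definition independent :: "('a \<times> 'a) set \<Rightarrow> 'a set \<Rightarrow> bool" where
  "independent E A \<longleftrightarrow> (\<forall>x\<in>A. \<forall>y\<in>A. (x, y) \<notin> E)"

text \<open>
  The exception for independent \<open>A\<close> cannot be avoided: if \<open>|A| = m\<close> and \<open>u \<in> A\<close> is adjacent to all
  of \<open>A - {u}\<close> and forces \<open>v\<close>, then a colouring that gives \<open>m\<close> different colours to \<open>A - {u}\<close> and \<open>v\<close>
  leaves none for \<open>u\<close>.
\<close>

definition flexible :: "('a \<times> 'a) set \<Rightarrow> nat \<Rightarrow> 'a set \<Rightarrow> 'a set \<Rightarrow> bool" where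
  "flexible E m S A \<longleftrightarrow>
     (\<forall>f. proper_colouring E m A f \<and> (f ` A \<noteq> {..<m} \<or> \<not> independent E A) \<longrightarrow>
       (\<exists>g. proper_colouring E m S g \<and> (\<forall>x\<in>A. g x = f x)))"

lemma flexible_refl: "flexible E m A A"
  unfolding flexible_def by blast

text \<open>
  Given a colouring \<open>f\<close> of the new frontier, a colour for \<open>u\<close> is needed that avoids those of \<open>v\<close> and
  of the neighbours of \<open>u\<close> in \<open>A\<close>. If \<open>f\<close> misses a colour, \<open>u\<close> takes it; should this make the
  colouring of \<open>A\<close> exceptional, then \<open>A\<close> is independent and \<open>u\<close> can repeat a colour instead. If \<open>f\<close>
  misses none, it is injective, and \<open>u\<close> repeats the colour of a non-neighbour in \<open>A\<close>.
\<close>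

lemma flexible_force:
  assumes sym: "sym E" and irrefl: "irrefl E"
    and triangle_free: "\<And>x y z. \<lbrakk>(x, y) \<in> E; (y, z) \<in> E; (x, z) \<in> E\<rbrakk> \<Longrightarrow> False"
    and m: "3 \<le> m"
    and A: "A \<subseteq> S" "finite A" "card A \<le> m"
    and closed: "\<And>x y. \<lbrakk>x \<in> S - A; (x, y) \<in> E\<rbrakk> \<Longrightarrow> y \<in> S"
    and flex: "flexible E m S A"
    and u: "u \<in> A" and v: "v \<notin> S" and uv: "(u, v) \<in> E"
  shows "flexible E m (insert v S) (insert v (A - {u}))"
proof -
  let ?A' = "insert v (A - {u})"
  have E_sym: "(y, x) \<in> E" if "(x, y) \<in> E" for x y
    using that sym by (blast dest: symD)
  have E_irrefl: "(x, x) \<notin> E" for x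
    using irrefl by (auto simp: irrefl_def)
  have vA: "v \<notin> A" using v A by blast
  have card_A': "card ?A' \<le> m"
    using A u vA card_Suc_Diff1[of A u] by simp
  have "\<exists>g. proper_colouring E m (insert v S) g \<and> (\<forall>x\<in>?A'. g x = f x)"
    if f: "proper_colouring E m ?A' f" and good: "f ` ?A' \<noteq> {..<m} \<or> \<not> independent E ?A'" for f
  proof -
    have f_lt: "f x < m" if "x \<in> ?A'" for x
      using f that unfolding proper_colouring_def by blast
    have f_ne: "f x \<noteq> f y" if "x \<in> ?A'" "y \<in> ?A'" "(x, y) \<in> E" for x y
      using f that unfolding proper_colouring_def by blast
    \<comment> \<open>It remains to find a colour \<open>a\<close> for \<open>u\<close> for which the resulting colouring of the old
      frontier is proper and not exceptional.\<close>
    have extend: ?thesis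
      if a: "a < m" "a \<noteq> f v" "\<And>w. \<lbrakk>w \<in> A - {u}; (u, w) \<in> E\<rbrakk> \<Longrightarrow> f w \<noteq> a"
        and ok: "f(u := a) ` A \<noteq> {..<m} \<or> \<not> independent E A" for a
    proof -
      have "proper_colouring E m A (f(u := a))"
        unfolding proper_colouring_def
      proof (intro conjI ballI impI)
        show "f(u := a) ` A \<subseteq> {..<m}"
          using f_lt a(1) by auto
        fix x y assume "x \<in> A" "y \<in> A" "(x, y) \<in> E"
        then show "(f(u := a)) x \<noteq> (f(u := a)) y"
          using a(3)[of x] a(3)[of y] f_ne[of x y] E_sym[of x y] E_irrefl[of u] by auto
      qed
      then obtain g where g: "proper_colouring E m S g" "\<And>x. x \<in> A \<Longrightarrow> g x = (f(u := a)) x"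
        using flex ok unfolding flexible_def by blast
      \<comment> \<open>All black neighbours of \<open>v\<close> lie in the old frontier.\<close>
      have v_ne: "g w \<noteq> f v" if "w \<in> S" "(w, v) \<in> E" for w
      proof -
        have "w \<in> A" using closed[of w v] that v by blast
        then show ?thesis
          using g(2)[of w] f_ne[of w v] a(2) that by auto
      qed
      have "proper_colouring E m (insert v S) (g(v := f v))"
        unfolding proper_colouring_def
      proof (intro conjI ballI impI)
        show "g(v := f v) ` insert v S \<subseteq> {..<m}"
          using g(1) f_lt[of v] unfolding proper_colouring_def by auto
        fix x y assume "x \<in> insert v S" "y \<in> insert v S" "(x, y) \<in> E"
        then show "(g(v := f v)) x \<noteq> (g(v := f v)) y"
          using v_ne[of x] v_ne[of y] E_sym[of x y] E_irrefl[of v] g(1)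
          unfolding proper_colouring_def by auto
      qed
      moreover have "\<forall>x\<in>?A'. (g(v := f v)) x = f x"
        using g(2) by auto
      ultimately show ?thesis by blast
    qed
    show ?thesis
    proof (cases "f ` ?A' = {..<m}")
      case False
      have "f ` ?A' \<subseteq> {..<m}" using f_lt by blast
      with False obtain a where a: "a < m" "a \<notin> f ` ?A'" by blast
      show ?thesis
      proof (cases "f(u := a) ` A \<noteq> {..<m} \<or> \<not> independent E A")
        case True
        with a show ?thesis by (intro extend[of a]) auto
      next
        case blocked: False
        \<comment> \<open>Now \<open>A\<close> is independent, so \<open>u\<close> may share the colour of any vertex of \<open>A - {u}\<close>. With
          three colours there is one that is neither \<open>a\<close> nor the colour of \<open>v\<close>, and \<open>a\<close> then stays
          unused.\<close>
        have "card {a, f v} < card {..<m}"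
          using m card_insert_le_m1[of 2 "{f v}" a] by simp
        then have "\<not> {..<m} \<subseteq> {a, f v}"
          using card_mono[of "{a, f v}" "{..<m}"] by auto
        then obtain b where b: "b < m" "b \<noteq> a" "b \<noteq> f v" by blast
        then have "b \<in> f(u := a) ` A" using blocked by blast
        with b obtain z where z: "z \<in> A - {u}" "f z = b"
          by (auto split: if_splits)
        have "a \<notin> f(u := b) ` A" using a b by auto
        then have "f(u := b) ` A \<noteq> {..<m}" using a by blast
        moreover have "(u, w) \<notin> E" if "w \<in> A" for w
          using blocked u that unfolding independent_def by blast
        ultimately show ?thesis
          using b by (intro extend[of b]) auto
      qed
    next
      case True
      then have inj: "inj_on f ?A'"
      proof (intro eq_card_imp_inj_on)
        have "card ?A' \<le> card (f ` ?A')" using card_A' by (simp only: True card_lessThan)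
        moreover have "card (f ` ?A') \<le> card ?A'" using A by (intro card_image_le) simp
        ultimately show "card (f ` ?A') = card ?A'" by linarith
      qed (use A in simp)
      have "\<exists>z\<in>A - {u}. (u, z) \<notin> E"
      proof (rule ccontr)
        assume "\<not> (\<exists>z\<in>A - {u}. (u, z) \<notin> E)"
        then have "(u, z) \<in> E" if "z \<in> ?A'" for z using that uv by blast
        then have "independent E ?A'"
          unfolding independent_def using triangle_free by blast
        then show False using good True by blast
      qed
      then obtain z where z: "z \<in> A - {u}" "(u, z) \<notin> E" by blast
      \<comment> \<open>The colour of \<open>v\<close> occurs only once, so it is unused when \<open>u\<close> takes the colour of \<open>z\<close>.\<close>
      have v_once: "f v \<noteq> f w" if "w \<in> A - {u}" for w
        using inj_onD[OF inj, of w v] that vA by auto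
      then have "f v \<notin> f(u := f z) ` A" using z by auto
      then have "f(u := f z) ` A \<noteq> {..<m}" using f_lt[of v] by blast
      moreover have "f w \<noteq> f z" if "w \<in> A - {u}" "(u, w) \<in> E" for w
        using inj_onD[OF inj, of w z] that z by auto
      ultimately show ?thesis
        using z f_lt[of z] v_once[of z] by (intro extend[of "f z"]) auto
    qed
  qed
  then show ?thesis unfolding flexible_def by blast
qed

text \<open>
  A constant colouring is not exceptional if \<open>A\<close> is independent, and an injective one is not
  exceptional if \<open>A\<close> is not.
\<close>

lemma flexible_imp_colouring:
  assumes "flexible E m S A" "irrefl E" "finite A" "card A \<le> m" "2 \<le> m"
  shows "\<exists>g. proper_colouring E m S g"
proof (cases "independent E A")
  case True
  have "(1::nat) \<notin> (\<lambda>_. 0) ` A" by auto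
  then have "(\<lambda>_. 0) ` A \<noteq> {..<m}" using assms(5) by auto
  moreover have "proper_colouring E m A (\<lambda>_. 0)"
    using True assms(5) unfolding proper_colouring_def independent_def by auto
  ultimately show ?thesis using assms(1) unfolding flexible_def by blast
next
  case False
  obtain f :: "'a \<Rightarrow> nat" where f: "bij_betw f A {0..<card A}"
    using ex_bij_betw_finite_nat[OF assms(3)] by blast
  have "proper_colouring E m A f"
    using f assms(2,4) unfolding proper_colouring_def bij_betw_def irrefl_def
    by (auto dest: inj_onD)
  then show ?thesis using assms(1) False unfolding flexible_def by blast
qed

text \<open>
  The frontier itself does not occur in \<open>forcing_step\<close>; it is recovered through the condition that
  black vertices outside \<open>A\<close> have only black neighbours, which places every forcing vertex in \<open>A\<close>.
\<close>

lemma forcing_flexible_frontier: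
  assumes E: "sym (parcs G)" "irrefl (parcs G)"
    "\<And>x y z. \<lbrakk>(x, y) \<in> parcs G; (y, z) \<in> parcs G; (x, z) \<in> parcs G\<rbrakk> \<Longrightarrow> False"
    and m: "3 \<le> m" and B: "finite B" "card B \<le> m"
    and forcing: "(forcing_step G)\<^sup>*\<^sup>* B S"
  shows "\<exists>A\<subseteq>S. finite A \<and> card A \<le> m \<and> flexible (parcs G) m S A \<and>
    (\<forall>x\<in>S - A. \<forall>y. (x, y) \<in> parcs G \<longrightarrow> y \<in> S)"
  using forcing
proof (induction rule: rtranclp_induct)
  case base
  show ?case using B flexible_refl by blast
next
  case (step S T)
  then obtain A where A: "A \<subseteq> S" "finite A" "card A \<le> m" "flexible (parcs G) m S A"
    and closed: "\<And>x y. \<lbrakk>x \<in> S - A; (x, y) \<in> parcs G\<rbrakk> \<Longrightarrow> y \<in> S"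
    by blast
  from step.hyps(2) obtain u v where u: "u \<in> S" and T: "T = insert v S"
    and white: "{w. (u, w) \<in> parcs G \<and> w \<notin> S} = {v}"
    by (blast elim: forcing_step.cases)
  have v: "(u, v) \<in> parcs G" "v \<notin> S" using white by blast+
  have uA: "u \<in> A" using u v closed by blast
  let ?A' = "insert v (A - {u})"
  have "flexible (parcs G) m T ?A'"
    unfolding T
  proof (rule flexible_force[OF E(1,2) _ m A(1-3) _ A(4) uA v(2,1)])
  qed (fact E(3), fact closed)
  moreover have "card ?A' \<le> m"
    using A uA v card_Suc_Diff1[of A u] by (subst card_insert_disjoint) auto
  moreover have "\<forall>x\<in>T - ?A'. \<forall>y. (x, y) \<in> parcs G \<longrightarrow> y \<in> T"
    unfolding T using closed white by blast
  moreover have "?A' \<subseteq> T" "finite ?A'" using A T by auto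
  ultimately show ?case by blast
qed

lemma triangle_free_colourable:
  assumes "pair_graph G" "triangle_free G" "zero_forcing_set G B" "card B \<le> m" "3 \<le> m"
  shows "colourable G m"
proof -
  interpret pair_graph G by fact
  have E: "sym (parcs G)" "irrefl (parcs G)"
    using pair_sym_arcs by (auto simp: symmetric_def irrefl_def dest: pair_no_loops)
  have tri: False if "(x, y) \<in> parcs G" "(y, z) \<in> parcs G" "(x, z) \<in> parcs G" for x y z
    using assms(2) that triangle_free_iff[OF assms(1)] by blast
  have "B \<subseteq> pverts G" and forcing: "(forcing_step G)\<^sup>*\<^sup>* B (pverts G)"
    using assms(3) unfolding zero_forcing_set_def by simp_all
  then have "finite B" using pair_finite_verts by (simp add: finite_subset)
  obtain A where "finite A" "card A \<le> m" "flexible (parcs G) m (pverts G) A"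
    using forcing_flexible_frontier[OF E _ assms(5) \<open>finite B\<close> assms(4) forcing] tri by meson
  then obtain g where "proper_colouring (parcs G) m (pverts G) g"
    using flexible_imp_colouring[OF _ E(2), of m "pverts G" A] assms(5) by auto
  then show ?thesis
    unfolding colourable_def proper_colouring_def
    by (intro exI[of _ g]) (auto dest: in_arcsD1 in_arcsD2)
qed

theorem corollary3:
  fixes G :: "'a pair_pre_digraph"
  assumes "pair_graph G"
    and "triangle_free G"
  shows "chromatic_number G \<le> max 3 (zero_forcing_number G) \<and>
    (zero_forcing_number G \<ge> 3 \<longrightarrow> chromatic_number G \<le> zero_forcing_number G)"
proof -
  obtain B where "zero_forcing_set G B" "card B = zero_forcing_number G"
    using zero_forcing_number_attained by blast
  then have "colourable G (max 3 (zero_forcing_number G))"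
    using assms by (intro triangle_free_colourable) auto
  then have "chromatic_number G \<le> max 3 (zero_forcing_number G)"
    unfolding chromatic_number_def by (rule Least_le)
  then show ?thesis by auto
qed

end
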